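(* Let $a\in\mathbb{R}^k$, $A\in\mathbb{R}^{k\times d}$, $A'\in\mathbb{R}^{k\times m}$ and let $P_A=\{(x,y)\in\mathbb{R}^{d+m}\mid a+Ax+A'y\ge0\}$ be a nonempty polyhedron such that $\pi(P_A)$ is bounded. Then the quadratic module $$\mathcal{M}^1(\pi,A)=\left\{s_0+\sum_{i=1}^ks_i(x)(a+Ax)_i\ \middle|\ \sum_{i=1}^ks_i(x)A'_{i,j}=0\ \forall j\in\{1,\dots,m\},\ s_0,\dots,s_k\in\Sigma[x]\right\}$$ is Archimedean and contains every polynomial in $\mathbb{R}[x]$ that is positive on $\pi(P_A)$.
   Context: $x=(x_1,\dots,x_d)$; $\pi(P_A)=\{x\in\mathbb{R}^d\mid\exists y\in\mathbb{R}^m:\ a+Ax+A'y\ge0\}$, with entrywise inequalities; $A'_{i,j}$ is the $(i,j)$ entry of $A'$. $\Sigma[x]$ is the set of sums of squares of polynomials in $\mathbb{R}[x]$. The quadratic module is Archimedean if it contains $N-x^Tx$ for some positive integer $N$. *)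

theory Defs
  imports "HOL-Analysis.Analysis" "HOL-Library.Poly_Mapping"
begin

text \<open>
  \<open>\<real>[x]\<close>, with variables indexed by a finite type \<open>'d\<close>: finitely supported maps from exponent
  vectors to coefficients. The ring structure of \<^theory>\<open>HOL-Library.Poly_Mapping\<close> has the
  convolution product as multiplication.
\<close>

type_synonym 'd rpoly = "('d \<Rightarrow>\<^sub>0 nat) \<Rightarrow>\<^sub>0 real"

definition pconst :: "real \<Rightarrow> 'd rpoly" where
  "pconst c = Poly_Mapping.single 0 c"

definition pvar :: "'d \<Rightarrow> 'd rpoly" where
  "pvar i = Poly_Mapping.single (Poly_Mapping.single i 1) 1"

definition peval :: "('d::finite) rpoly \<Rightarrow> real ^ 'd \<Rightarrow> real" where
  "peval p x = (\<Sum>e\<in>Poly_Mapping.keys p.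
     Poly_Mapping.lookup p e * (\<Prod>i\<in>UNIV. (x $ i) ^ Poly_Mapping.lookup e i))"

definition sos :: "('d::finite) rpoly set" where
  "sos = {p. \<exists>(n::nat) q. p = (\<Sum>l<n. (q l)\<^sup>2)}"

definition quadratic_module :: "('d::finite) rpoly set \<Rightarrow> bool" where
  "quadratic_module M \<longleftrightarrow>
     1 \<in> M \<and> (\<forall>p\<in>M. \<forall>q\<in>M. p + q \<in> M) \<and> (\<forall>p\<in>M. \<forall>s\<in>sos. s * p \<in> M)"

definition archimedean :: "('d::finite) rpoly set \<Rightarrow> bool" where
  "archimedean M \<longleftrightarrow>
     (\<exists>N::nat. N > 0 \<and> pconst (real N) - (\<Sum>i\<in>UNIV. (pvar i)\<^sup>2) \<in> M)"

text \<open>The order on \<open>real ^ 'k\<close> is entrywise.\<close>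

definition lifted_polyhedron ::
    "real ^ 'k \<Rightarrow> real ^ 'd ^ 'k \<Rightarrow> real ^ 'm ^ 'k \<Rightarrow> ((real ^ 'd) \<times> (real ^ 'm)) set" where
  "lifted_polyhedron a A A' = {(x, y). 0 \<le> a + A *v x + A' *v y}"

definition projected_polyhedron ::
    "real ^ 'k \<Rightarrow> real ^ 'd ^ 'k \<Rightarrow> real ^ 'm ^ 'k \<Rightarrow> (real ^ 'd) set" where
  "projected_polyhedron a A A' = {x. \<exists>y. (x, y) \<in> lifted_polyhedron a A A'}"

text \<open>The polynomial \<open>(a + A x)\<^sub>i\<close>.\<close>

definition affine_poly :: "real ^ 'k \<Rightarrow> real ^ 'd ^ 'k \<Rightarrow> 'k \<Rightarrow> ('d::finite) rpoly" where
  "affine_poly a A i = pconst (a $ i) + (\<Sum>j\<in>UNIV. pconst (A $ i $ j) * pvar j)"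

definition lifted_module ::
    "real ^ 'k \<Rightarrow> real ^ 'd ^ 'k \<Rightarrow> real ^ 'm ^ 'k \<Rightarrow> ('d::finite) rpoly set" where
  "lifted_module a A A' =
     {s\<^sub>0 + (\<Sum>i\<in>UNIV. s i * affine_poly a A i) | s\<^sub>0 s.
        (\<forall>j. (\<Sum>i\<in>UNIV. s i * pconst (A' $ i $ j)) = 0) \<and> s\<^sub>0 \<in> sos \<and> (\<forall>i. s i \<in> sos)}"

end

theory Submission
  imports Defs
begin

text \<open>
  Two facts are combined: linear programming duality for the polyhedron, and Putinar's
  Positivstellensatz for an arbitrary Archimedean quadratic module.

  The link between the polyhedron and the module is that nonnegative constants are sums of squares.
  A Farkas multiplier \<open>l \<ge> 0\<close> with \<open>\<Sum>\<^sub>i l\<^sub>i A'\<^sub>i = 0\<close> is therefore an admissible choice of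
  \<open>s\<^sub>1, \<dots>, s\<^sub>k\<close>, and it puts the affine polynomial \<open>\<Sum>\<^sub>i l\<^sub>i (a + A x)\<^sub>i\<close> into the module. Duality
  yields such multipliers in two situations. Every affine function that is nonnegative on the
  projection lies in the module (\<open>affine_nonneg_in_lifted_module\<close>); applied to \<open>r \<plusminus> x\<^sub>i\<close> this gives the
  Archimedean property. A point outside the projection is cut off by an element of the module that is
  negative there, so the projection contains every point at which all elements of the module are
  nonnegative (\<open>nonneg_on_lifted_module_imp_in_projection\<close>). It remains to apply \<open>putinar\<close>.

  Putinar's theorem is proved algebraically. If \<open>f\<close> is not in \<open>M\<close>, then \<open>M - \<Sigma> f\<close> is still
  proper; this is the cancellation lemma \<open>qm_cancel_sos\<close>, by which \<open>s f - 1 \<in> M\<close> with \<open>s\<close> a sum of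
  squares already forces \<open>f \<in> M\<close>. Enlarge it by Zorn's lemma to a maximal proper quadratic module
  \<open>Q\<close>. By the cancellation lemma again \<open>Q\<close> is total, meaning that it contains \<open>g\<close> or \<open>- g\<close> for each
  \<open>g\<close>. So \<open>Q\<close> behaves like a nonnegativity relation in which every polynomial, being bounded, is
  infinitely close to a real constant. The constants \<open>x\<^sub>i\<close> close to the variables form a point \<open>x\<close>,
  and as the infinitesimals are closed under sums and products, every polynomial \<open>p\<close> is infinitely
  close to \<open>p(x)\<close>. Consequently all elements of \<open>Q\<close>, among them \<open>- f\<close> and those of \<open>M\<close>, are
  nonnegative at \<open>x\<close>, so \<open>f\<close> is not positive wherever \<open>M\<close> is nonnegative.
\<close>

section \<open>Polynomials and their evaluation\<close>

lemma pconst_0 [simp]: "pconst 0 = 0"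
  and pconst_1 [simp]: "pconst 1 = 1"
  by (simp_all add: pconst_def)

lemma pconst_add: "pconst (b + c) = pconst b + pconst c"
  and pconst_diff: "pconst (b - c) = pconst b - pconst c"
  and pconst_uminus: "pconst (- c) = - pconst c"
  and pconst_mult: "pconst (b * c) = pconst b * pconst c"
  by (simp_all add: pconst_def single_add single_diff single_uminus mult_single)

lemma pconst_sum: "pconst (sum f S) = (\<Sum>i\<in>S. pconst (f i))"
  by (induction S rule: infinite_finite_induct) (auto simp: pconst_add)

lemma pconst_numeral: "pconst (numeral n) = numeral n"
  by (simp add: pconst_def)

lemma poly_mapping_eq_sum_single:
  "p = (\<Sum>e\<in>Poly_Mapping.keys p. Poly_Mapping.single e (Poly_Mapping.lookup p e))"
proof (rule poly_mapping_eqI)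
  fix k
  have "(\<Sum>e\<in>Poly_Mapping.keys p. Poly_Mapping.lookup p e when e = k)
      = (\<Sum>e\<in>Poly_Mapping.keys p. if e = k then Poly_Mapping.lookup p k else 0)"
    by (intro sum.cong) auto
  also have "\<dots> = Poly_Mapping.lookup p k"
    by (simp add: in_keys_iff)
  finally show "Poly_Mapping.lookup p k
      = Poly_Mapping.lookup (\<Sum>e\<in>Poly_Mapping.keys p. Poly_Mapping.single e (Poly_Mapping.lookup p e)) k"
    by (simp add: lookup_sum lookup_single)
qed

lemma pvar_power: "pvar i ^ n = Poly_Mapping.single (Poly_Mapping.single i n) 1"
  by (induction n) (auto simp: pvar_def mult_single simp flip: single_add)

lemma prod_single_1:
  "finite S \<Longrightarrow> (\<Prod>i\<in>S. Poly_Mapping.single (e i) (1::real)) = Poly_Mapping.single (\<Sum>i\<in>S. e i) 1"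
  by (induction S rule: finite_induct) (auto simp: mult_single)

lemma single_eq_monomial:
  fixes e :: "'d::finite \<Rightarrow>\<^sub>0 nat"
  shows "Poly_Mapping.single e c = pconst c * (\<Prod>i\<in>UNIV. pvar i ^ Poly_Mapping.lookup e i)"
proof -
  have "(\<Sum>i\<in>UNIV. Poly_Mapping.single i (Poly_Mapping.lookup e i)) = e"
    by (rule poly_mapping_eqI) (simp add: lookup_sum lookup_single when_def)
  then show ?thesis
    by (simp add: pvar_power prod_single_1 pconst_def mult_single)
qed

lemma rpoly_induct [case_names const var add mult]:
  fixes p :: "('d::finite) rpoly"
  assumes const: "\<And>c. P (pconst c)" and var: "\<And>i. P (pvar i)"
    and add: "\<And>p q. P p \<Longrightarrow> P q \<Longrightarrow> P (p + q)"
    and mult: "\<And>p q. P p \<Longrightarrow> P q \<Longrightarrow> P (p * q)"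
  shows "P p"
proof -
  have sum: "P (sum f S)" if "\<And>i. i \<in> S \<Longrightarrow> P (f i)" for f :: "('d \<Rightarrow>\<^sub>0 nat) \<Rightarrow> 'd rpoly" and S
    using that const[of 0] by (induction S rule: infinite_finite_induct) (auto intro: add)
  have pow: "P (pvar i ^ n)" for i n
    using const[of 1] by (induction n) (auto intro: mult var)
  have prod: "P (\<Prod>i\<in>S. pvar i ^ n i)" for S :: "'d set" and n
    using const[of 1] by (induction S rule: infinite_finite_induct) (auto intro: mult pow)
  have "P (\<Sum>e\<in>Poly_Mapping.keys p. Poly_Mapping.single e (Poly_Mapping.lookup p e))"
    by (rule sum) (auto simp: single_eq_monomial intro: mult const prod)
  then show ?thesis
    by (simp flip: poly_mapping_eq_sum_single)
qed

lemma peval_eq_sum_superset: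
  assumes "finite S" "Poly_Mapping.keys p \<subseteq> S"
  shows "peval p x = (\<Sum>e\<in>S. Poly_Mapping.lookup p e * (\<Prod>i\<in>UNIV. (x $ i) ^ Poly_Mapping.lookup e i))"
  unfolding peval_def by (rule sum.mono_neutral_left) (use assms in \<open>auto simp: in_keys_iff\<close>)

lemma peval_add: "peval (p + q) x = peval p x + peval q x"
proof -
  let ?S = "Poly_Mapping.keys p \<union> Poly_Mapping.keys q"
  have "Poly_Mapping.keys (p + q) \<subseteq> ?S"
    by (rule keys_add)
  then show ?thesis
    by (simp add: peval_eq_sum_superset[of ?S] lookup_add distrib_right sum.distrib)
qed

lemma peval_single:
  "peval (Poly_Mapping.single e c) x = c * (\<Prod>i\<in>UNIV. (x $ i) ^ Poly_Mapping.lookup e i)"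
  by (subst peval_eq_sum_superset[of "{e}"]) auto

lemma peval_pconst [simp]: "peval (pconst c) x = c"
  by (simp add: pconst_def peval_single)

lemma peval_pvar [simp]: "peval (pvar i) x = x $ i"
proof -
  have "(\<Prod>j\<in>UNIV. (x $ j) ^ Poly_Mapping.lookup (Poly_Mapping.single i (1::nat)) j)
      = (\<Prod>j\<in>UNIV. if j = i then x $ j else 1)"
    by (intro prod.cong) (auto simp: lookup_single when_def)
  then show ?thesis
    by (simp add: pvar_def peval_single)
qed

lemma peval_sum: "peval (sum f S) x = (\<Sum>i\<in>S. peval (f i) x)"
  by (induction S rule: infinite_finite_induct)
    (use peval_pconst[of 0 x] in \<open>auto simp: peval_add\<close>)

lemma peval_mult: "peval (p * q) x = peval p x * peval q x"
proof -
  let ?m = "\<lambda>p e. Poly_Mapping.single e (Poly_Mapping.lookup p e)"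
  have "p * q = (\<Sum>e\<in>Poly_Mapping.keys p. ?m p e) * (\<Sum>f\<in>Poly_Mapping.keys q. ?m q f)"
    by (simp flip: poly_mapping_eq_sum_single)
  then have product: "peval (p * q) x
      = (\<Sum>e\<in>Poly_Mapping.keys p. \<Sum>f\<in>Poly_Mapping.keys q. peval (?m p e) x * peval (?m q f) x)"
    by (simp add: sum_product peval_sum mult_single peval_single lookup_add power_add
        prod.distrib mult_ac)
  have split: "peval r x = (\<Sum>e\<in>Poly_Mapping.keys r. peval (?m r e) x)" for r
    unfolding peval_single by (simp add: peval_def)
  show ?thesis
    by (simp only: product split[of p] split[of q] sum_product)
qed

lemma peval_uminus: "peval (- p) x = - peval p x"
  using peval_add[of p "- p" x] peval_pconst[of 0 x] by simp

section \<open>Sums of squares and quadratic modules\<close>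

lemma sos_0 [simp]: "0 \<in> sos"
  unfolding sos_def by (auto intro!: exI[of _ 0])

lemma sos_add_square:
  assumes "p \<in> sos" shows "p + q\<^sup>2 \<in> sos"
proof -
  obtain n r where p: "p = (\<Sum>l<(n::nat). (r l)\<^sup>2)"
    using assms by (auto simp: sos_def)
  have "p + q\<^sup>2 = (\<Sum>l<Suc n. ((r(n := q)) l)\<^sup>2)"
    by (simp add: p)
  then show ?thesis
    unfolding sos_def by blast
qed

lemma sos_induct [consumes 1, case_names 0 add]:
  assumes "p \<in> sos" and "P 0" and step: "\<And>p q. P p \<Longrightarrow> P (p + q\<^sup>2)"
  shows "P p"
proof -
  obtain n r where p: "p = (\<Sum>l<(n::nat). (r l)\<^sup>2)"
    using assms(1) by (auto simp: sos_def)
  show ?thesis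
    unfolding p by (induction n) (auto intro: assms)
qed

lemma sos_square [simp]: "q\<^sup>2 \<in> sos"
  using sos_add_square[OF sos_0] by simp

lemma sos_1 [simp]: "1 \<in> sos"
  using sos_square[of 1] by simp

lemma sos_add:
  assumes "p \<in> sos" "q \<in> sos" shows "p + q \<in> sos"
  using assms(2)
proof (induction rule: sos_induct)
  case (add q r)
  then show ?case using sos_add_square[of "p + q" r] by (simp add: add.assoc)
qed (use assms in auto)

lemma sos_mult:
  assumes "p \<in> sos" "q \<in> sos" shows "p * q \<in> sos"
  using assms(2)
proof (induction rule: sos_induct)
  case (add q r)
  have "p * r\<^sup>2 \<in> sos"
    using assms(1)
    by (induction rule: sos_induct) (auto simp: distrib_right sos_add_square simp flip: power_mult_distrib)
  with add show ?case by (simp add: distrib_left sos_add)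
qed auto

lemma sos_sum: "(\<And>i. i \<in> S \<Longrightarrow> f i \<in> sos) \<Longrightarrow> sum f S \<in> sos"
  by (induction S rule: infinite_finite_induct) (auto intro: sos_add)

lemma sos_pconst: "c \<ge> 0 \<Longrightarrow> pconst c \<in> sos"
  using sos_square[of "pconst (sqrt c)"] by (simp add: power2_eq_square flip: pconst_mult)

context
  fixes M :: "('d::finite) rpoly set"
  assumes M: "quadratic_module M"
begin

lemma qm_add: "p \<in> M \<Longrightarrow> q \<in> M \<Longrightarrow> p + q \<in> M"
  and qm_mult: "s \<in> sos \<Longrightarrow> p \<in> M \<Longrightarrow> s * p \<in> M"
  using M by (auto simp: quadratic_module_def)

lemma qm_sos: "s \<in> sos \<Longrightarrow> s \<in> M"
  using M qm_mult[of s 1] by (auto simp: quadratic_module_def)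

lemma qm_pconst: "c \<ge> 0 \<Longrightarrow> pconst c \<in> M"
  by (simp add: qm_sos sos_pconst)

lemma qm_sum: "(\<And>i. i \<in> S \<Longrightarrow> f i \<in> M) \<Longrightarrow> sum f S \<in> M"
  by (induction S rule: infinite_finite_induct) (auto intro: qm_add qm_sos)

lemma qm_scale: "c \<ge> 0 \<Longrightarrow> p \<in> M \<Longrightarrow> pconst c * p \<in> M"
  by (simp add: qm_mult sos_pconst)

lemma qm_scale_cancel:
  assumes "c > 0" "pconst c * p \<in> M" shows "p \<in> M"
proof -
  have "pconst (1 / c) * (pconst c * p) = p"
    using assms(1) by (simp flip: mult.assoc pconst_mult)
  then show ?thesis
    using qm_scale[of "1 / c" "pconst c * p"] assms by simp
qed

lemma qm_mono_pconst: "p + pconst b \<in> M \<Longrightarrow> b \<le> c \<Longrightarrow> p + pconst c \<in> M"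
  using qm_add[of "p + pconst b" "pconst (c - b)"] qm_pconst[of "c - b"] by (simp add: pconst_diff)

text \<open>
  Only elements of \<open>M\<close> multiplied by sums of squares are available, so \<open>(c - p)(c + p)\<close> itself is
  out of reach. Weighting each of the two bounds with the square of the other gives
  \<open>(c - p)\<^sup>2 (c + p) + (c + p)\<^sup>2 (c - p) = 2 c (c\<^sup>2 - p\<^sup>2)\<close>, the same product up to a positive constant.
\<close>

lemma qm_square_bound:
  assumes "pconst c - p \<in> M" "pconst c + p \<in> M" "c > 0"
  shows "pconst (c\<^sup>2) - p\<^sup>2 \<in> M"
proof (rule qm_scale_cancel)
  have "(pconst c - p)\<^sup>2 * (pconst c + p) + (pconst c + p)\<^sup>2 * (pconst c - p) \<in> M"
    by (rule qm_add; rule qm_mult) (use assms in auto)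
  also have "(pconst c - p)\<^sup>2 * (pconst c + p) + (pconst c + p)\<^sup>2 * (pconst c - p)
      = pconst (2 * c) * (pconst (c\<^sup>2) - p\<^sup>2)"
    by (simp add: pconst_mult pconst_numeral power2_eq_square algebra_simps)
  finally show "pconst (2 * c) * (pconst (c\<^sup>2) - p\<^sup>2) \<in> M" .
qed (use assms in auto)

end

definition qm_bounded :: "('d::finite) rpoly set \<Rightarrow> 'd rpoly \<Rightarrow> bool" where
  "qm_bounded M p \<longleftrightarrow> (\<exists>c. pconst c - p \<in> M \<and> pconst c + p \<in> M)"

lemma qm_bounded_pos:
  assumes M: "quadratic_module M" and p: "qm_bounded M p"
  obtains c where "c > b" "pconst c - p \<in> M" "pconst c + p \<in> M"
proof -
  obtain c where c: "pconst c - p \<in> M" "pconst c + p \<in> M"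
    using p by (auto simp: qm_bounded_def)
  show ?thesis
    by (rule that[of "max c (b + 1)"])
      (use qm_mono_pconst[OF M, of "p" c "max c (b + 1)"] qm_mono_pconst[OF M, of "- p" c "max c (b + 1)"] c
       in \<open>auto simp: add.commute\<close>)
qed

lemma qm_bounded_add:
  assumes M: "quadratic_module M" and "qm_bounded M p" "qm_bounded M q"
  shows "qm_bounded M (p + q)"
proof -
  obtain b c where "pconst b - p \<in> M" "pconst b + p \<in> M" "pconst c - q \<in> M" "pconst c + q \<in> M"
    using assms by (auto simp: qm_bounded_def)
  then have "(pconst b - p) + (pconst c - q) \<in> M" "(pconst b + p) + (pconst c + q) \<in> M"
    by (auto intro: qm_add[OF M])
  then show ?thesis
    unfolding qm_bounded_def by (intro exI[of _ "b + c"]) (auto simp: pconst_add algebra_simps)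
qed

lemma qm_bounded_scale:
  assumes M: "quadratic_module M" and p: "qm_bounded M p"
  shows "qm_bounded M (pconst b * p)"
proof -
  have pos: "qm_bounded M (pconst b * p)" if b: "b \<ge> 0" and p: "qm_bounded M p" for b p
  proof -
    obtain c where "pconst c - p \<in> M" "pconst c + p \<in> M"
      using p by (auto simp: qm_bounded_def)
    then have "pconst b * (pconst c - p) \<in> M" "pconst b * (pconst c + p) \<in> M"
      using b by (auto intro: qm_scale[OF M])
    then show ?thesis
      unfolding qm_bounded_def by (intro exI[of _ "b * c"]) (auto simp: pconst_mult algebra_simps)
  qed
  have "qm_bounded M (- p)"
    using p by (auto simp: qm_bounded_def)
  then show ?thesis
    using pos[of b p] pos[of "- b" "- p"] p by (cases "b \<ge> 0") (auto simp: pconst_uminus)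
qed

lemma qm_bounded_square:
  assumes M: "quadratic_module M" and p: "qm_bounded M p"
  shows "qm_bounded M (p\<^sup>2)"
proof -
  obtain c where c: "c > 0" "pconst c - p \<in> M" "pconst c + p \<in> M"
    using qm_bounded_pos[OF M p, of 0] by blast
  have "pconst (c\<^sup>2) - p\<^sup>2 \<in> M"
    using c by (intro qm_square_bound[OF M])
  moreover have "pconst (c\<^sup>2) + p\<^sup>2 \<in> M"
    by (intro qm_sos[OF M] sos_add sos_pconst) auto
  ultimately show ?thesis
    by (auto simp: qm_bounded_def)
qed

text \<open>
  Polarization reduces closure under products to closure under squares, sums and real multiples,
  both for the bounded and for the infinitesimal polynomials.
\<close>

lemma mult_eq_polarized:
  fixes p q :: "'d rpoly"
  shows "p * q = pconst (1/4) * (p + q)\<^sup>2 + pconst (- 1/4) * (p + pconst (- 1) * q)\<^sup>2"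
proof -
  have 4: "pconst (1/4) * 4 = (1 :: 'd rpoly)"
    by (simp flip: pconst_mult pconst_numeral)
  have neg: "pconst (- 1/4) = (- pconst (1/4) :: 'd rpoly)" "pconst (- 1) = (- 1 :: 'd rpoly)"
    by (simp_all flip: pconst_uminus pconst_1)
  have "c * (p + q)\<^sup>2 + (- c) * (p + (- 1) * q)\<^sup>2 = c * 4 * (p * q)" for c
    by (simp add: power2_eq_square algebra_simps)
  then show ?thesis
    by (simp only: neg 4 mult_1_left)
qed

lemma qm_bounded_mult:
  assumes "quadratic_module M" "qm_bounded M p" "qm_bounded M q"
  shows "qm_bounded M (p * q)"
  unfolding mult_eq_polarized[of p q] using assms
  by (intro qm_bounded_add qm_bounded_scale qm_bounded_square)

text \<open>
  The bounded polynomials form a subalgebra, so it suffices to bound the variables. For these,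
  \<open>N - x\<^sub>i\<^sup>2 + (1 \<plusminus> x\<^sub>i)\<^sup>2 = 2 ((N + 1) / 2 \<plusminus> x\<^sub>i)\<close>.
\<close>

lemma archimedean_imp_qm_bounded:
  assumes M: "quadratic_module M" and arch: "archimedean M"
  shows "qm_bounded M p"
proof (induction p rule: rpoly_induct)
  case (const c)
  show ?case
    unfolding qm_bounded_def
    by (intro exI[of _ "\<bar>c\<bar>"]) (auto simp flip: pconst_add pconst_diff intro!: qm_pconst[OF M])
next
  case (var i)
  obtain N :: nat where N: "pconst (real N) - (\<Sum>i\<in>UNIV. (pvar i)\<^sup>2) \<in> M"
    using arch by (auto simp: archimedean_def)
  have "(\<Sum>j\<in>UNIV. (pvar j)\<^sup>2) = (pvar i)\<^sup>2 + (\<Sum>j\<in>UNIV - {i}. (pvar j :: 'a rpoly)\<^sup>2)"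
    by (simp add: sum.remove)
  then have "pconst (real N) - (pvar i)\<^sup>2
      = (pconst (real N) - (\<Sum>i\<in>UNIV. (pvar i)\<^sup>2)) + (\<Sum>j\<in>UNIV - {i}. (pvar j)\<^sup>2)"
    by simp
  also have "\<dots> \<in> M"
    by (intro qm_add[OF M] N qm_sos[OF M] sos_sum) auto
  finally have i: "pconst (real N) - (pvar i)\<^sup>2 \<in> M" .
  have bound: "pconst ((real N + 1) / 2) + q \<in> M" if "q\<^sup>2 = (pvar i)\<^sup>2" for q
  proof (rule qm_scale_cancel[OF M])
    have "(pconst (real N) - (pvar i)\<^sup>2) + (1 + q)\<^sup>2 \<in> M"
      by (intro qm_add[OF M] i qm_sos[OF M]) auto
    also have "(pconst (real N) - (pvar i)\<^sup>2) + (1 + q)\<^sup>2 = pconst (real N + 1) + pconst 2 * q"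
      using that by (simp add: pconst_add pconst_numeral power2_eq_square algebra_simps)
    also have "\<dots> = pconst 2 * (pconst ((real N + 1) / 2) + q)"
      by (simp add: distrib_left add_divide_distrib flip: pconst_mult)
    finally show "pconst 2 * (pconst ((real N + 1) / 2) + q) \<in> M" .
  qed auto
  show ?case
    unfolding qm_bounded_def using bound[of "pvar i"] bound[of "- pvar i"]
    by (intro exI[of _ "(real N + 1) / 2"]) auto
qed (use M in \<open>auto intro: qm_bounded_add qm_bounded_mult\<close>)

section \<open>Putinar's Positivstellensatz\<close>

text \<open>
  With \<open>N\<close> so large that \<open>2 N - s\<close> and \<open>2 N - 1 - s\<^sup>2 f\<close> lie in \<open>M\<close>, the identity
  \<open>N\<^sup>2 (f + r) - 1 = (N - s)\<^sup>2 (f + r) + 2 N (s f - 1) + (2 N - 1 - s\<^sup>2 f) + r s (2 N - s)\<close>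
  shows that \<open>f + r \<in> M\<close> with \<open>r \<ge> 0\<close> implies \<open>f + r - 1 / N\<^sup>2 \<in> M\<close>. Since \<open>N\<close> does not depend on
  \<open>r\<close>, finitely many steps of fixed size lead from a large \<open>r\<close> down to \<open>0\<close>.
\<close>

lemma qm_cancel_sos:
  assumes M: "quadratic_module M" and arch: "archimedean M"
    and s: "s \<in> sos" and sf: "s * f - 1 \<in> M"
  shows "f \<in> M"
proof -
  note bdd = archimedean_imp_qm_bounded[OF M arch]
  obtain b c where b: "b > 0" "pconst b - s \<in> M" and c: "c > 0" "pconst c - s\<^sup>2 * f \<in> M"
    using qm_bounded_pos[OF M bdd] by metis
  define N where "N = b + c + 1"
  have N: "N > 0" using b c by (simp add: N_def)
  have bN: "pconst (2 * N) - s \<in> M"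
    using qm_mono_pconst[OF M, of "- s" b "2 * N"] b c by (simp add: N_def add.commute)
  have cN: "pconst (2 * N - 1) - s\<^sup>2 * f \<in> M"
    using qm_mono_pconst[OF M, of "- (s\<^sup>2 * f)" c "2 * N - 1"] b c by (simp add: N_def add.commute)
  define \<delta> where "\<delta> = 1 / N\<^sup>2"
  have \<delta>: "\<delta> > 0" using N by (simp add: \<delta>_def)
  have step: "f + pconst (r - \<delta>) \<in> M" if "f + pconst r \<in> M" "r \<ge> 0" for r
  proof (rule qm_scale_cancel[OF M])
    have "(pconst N - s)\<^sup>2 * (f + pconst r) + pconst (2 * N) * (s * f - 1)
        + (pconst (2 * N - 1) - s\<^sup>2 * f) + pconst r * (s * (pconst (2 * N) - s)) \<in> M"
      using that N by (intro qm_add[OF M _ cN] qm_add[OF M _ qm_scale[OF M _ qm_mult[OF M s bN]]]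
          qm_add[OF M _ qm_scale[OF M _ sf]] qm_mult[OF M sos_square]) auto
    also have "(pconst N - s)\<^sup>2 * (f + pconst r) + pconst (2 * N) * (s * f - 1)
        + (pconst (2 * N - 1) - s\<^sup>2 * f) + pconst r * (s * (pconst (2 * N) - s))
      = pconst (N\<^sup>2) * (f + pconst r) - pconst (N\<^sup>2 * \<delta>)"
      using N by (simp add: \<delta>_def pconst_mult pconst_diff pconst_numeral power2_eq_square algebra_simps)
    also have "\<dots> = pconst (N\<^sup>2) * (f + pconst (r - \<delta>))"
      by (simp only: pconst_mult pconst_diff algebra_simps)
    finally show "pconst (N\<^sup>2) * (f + pconst (r - \<delta>)) \<in> M" .
  qed (use N in auto)
  obtain r0 where r0: "pconst r0 + f \<in> M" "r0 > 0"
    using qm_bounded_pos[OF M bdd] by metis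
  \<comment> \<open>The step is only valid from a nonnegative \<open>r\<close>, hence the truncation at \<open>0\<close>.\<close>
  have iter: "f + pconst (max 0 (r0 - real k * \<delta>)) \<in> M" for k
  proof (induction k)
    case 0
    then show ?case using r0 by (simp add: add.commute)
  next
    case (Suc k)
    then have "f + pconst (max 0 (r0 - real k * \<delta>) - \<delta>) \<in> M"
      by (intro step) auto
    then show ?case
      by (rule qm_mono_pconst[OF M]) (use \<delta> in \<open>auto simp: algebra_simps\<close>)
  qed
  obtain k where "r0 < real k * \<delta>"
    using reals_Archimedean3[OF \<delta>] by blast
  then show ?thesis
    using iter[of k] by simp
qed

definition qm_adjoin :: "('d::finite) rpoly set \<Rightarrow> 'd rpoly \<Rightarrow> 'd rpoly set" where
  "qm_adjoin M g = {m + s * g | m s. m \<in> M \<and> s \<in> sos}"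

lemma quadratic_module_qm_adjoin:
  assumes M: "quadratic_module M"
  shows "quadratic_module (qm_adjoin M g)"
  unfolding quadratic_module_def
proof (intro conjI ballI)
  have "1 = 1 + 0 * g" "1 \<in> M"
    using qm_sos[OF M sos_1] by auto
  then show "1 \<in> qm_adjoin M g"
    unfolding qm_adjoin_def using sos_0 by blast
  show "p + q \<in> qm_adjoin M g" if "p \<in> qm_adjoin M g" "q \<in> qm_adjoin M g" for p q
  proof -
    obtain m s n t where "p = m + s * g" "q = n + t * g" "m \<in> M" "n \<in> M" "s \<in> sos" "t \<in> sos"
      using \<open>p \<in> _\<close> \<open>q \<in> _\<close> by (auto simp: qm_adjoin_def)
    then show ?thesis
      unfolding qm_adjoin_def
      by (intro CollectI exI[of _ "m + n"] exI[of _ "s + t"]) (auto simp: distrib_right add_ac sos_add qm_add[OF M])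
  qed
  show "t * p \<in> qm_adjoin M g" if "p \<in> qm_adjoin M g" "t \<in> sos" for p t
  proof -
    obtain m s where "p = m + s * g" "m \<in> M" "s \<in> sos"
      using \<open>p \<in> _\<close> by (auto simp: qm_adjoin_def)
    then show ?thesis
      unfolding qm_adjoin_def using \<open>t \<in> sos\<close>
      by (intro CollectI exI[of _ "t * m"] exI[of _ "t * s"]) (auto simp: distrib_left mult.assoc sos_mult qm_mult[OF M])
  qed
qed

lemma qm_adjoin_superset: "M \<subseteq> qm_adjoin M g"
proof
  fix m assume "m \<in> M"
  then show "m \<in> qm_adjoin M g"
    unfolding qm_adjoin_def by (intro CollectI exI[of _ m] exI[of _ 0]) auto
qed

lemma qm_adjoin_mem: "quadratic_module M \<Longrightarrow> g \<in> qm_adjoin M g"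
  unfolding qm_adjoin_def using sos_1 qm_sos[OF _ sos_0]
  by (intro CollectI exI[of _ 0] exI[of _ 1]) auto

lemma qm_adjoin_improper:
  assumes "quadratic_module M" "archimedean M" "- 1 \<in> qm_adjoin M g"
  shows "- g \<in> M"
proof -
  obtain m s where eq: "- 1 = m + s * g" and "m \<in> M" "s \<in> sos"
    using assms(3) by (auto simp: qm_adjoin_def)
  have "s * (- g) - 1 = - 1 - s * g"
    by simp
  also have "\<dots> = m"
    by (simp only: eq add_diff_cancel_right')
  finally have "s * (- g) - 1 = m" .
  with \<open>m \<in> M\<close> \<open>s \<in> sos\<close> show ?thesis
    using qm_cancel_sos[OF assms(1,2), of s "- g"] by simp
qed

lemma archimedean_mono: "archimedean M \<Longrightarrow> M \<subseteq> Q \<Longrightarrow> archimedean Q"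
  by (auto simp: archimedean_def)

text \<open>
  A maximal proper quadratic module \<open>Q\<close> is total: if \<open>g\<close> cannot be adjoined properly, then
  \<open>- 1 = m + s g\<close> with \<open>m \<in> Q\<close>, so \<open>s (- g) - 1 \<in> Q\<close> and the cancellation lemma gives \<open>- g \<in> Q\<close>.
\<close>

lemma ex_total_quadratic_module:
  assumes M: "quadratic_module M" and arch: "archimedean M" and proper: "- 1 \<notin> M"
  obtains Q where "quadratic_module Q" "M \<subseteq> Q" "- 1 \<notin> Q" "\<And>g. g \<in> Q \<or> - g \<in> Q"
proof -
  let ?A = "{Q. quadratic_module Q \<and> M \<subseteq> Q \<and> - 1 \<notin> Q}"
  have "\<exists>Q\<in>?A. \<forall>X\<in>?A. Q \<subseteq> X \<longrightarrow> X = Q"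
  proof (rule subset_Zorn_nonempty)
    fix C assume C: "C \<noteq> {}" "subset.chain ?A C"
    have ch: "X \<subseteq> Y \<or> Y \<subseteq> X" if "X \<in> C" "Y \<in> C" for X Y
      using C that by (auto simp: subset_chain_def)
    have CA: "quadratic_module X" "M \<subseteq> X" "- 1 \<notin> X" if "X \<in> C" for X
      using C that by (auto simp: subset_chain_def)
    have "p + q \<in> \<Union>C" if pq: "p \<in> \<Union>C" "q \<in> \<Union>C" for p q
    proof -
      obtain X Y where "X \<in> C" "Y \<in> C" "p \<in> X" "q \<in> Y"
        using pq by auto
      then obtain Z where "Z \<in> C" "p \<in> Z" "q \<in> Z"
        using ch by blast
      then show ?thesis
        using qm_add[OF CA(1)] by blast
    qed
    moreover have "s * p \<in> \<Union>C" if "p \<in> \<Union>C" "s \<in> sos" for p s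
      using that qm_mult[OF CA(1)] by blast
    moreover have "1 \<in> \<Union>C"
      using C(1) qm_sos[OF CA(1) sos_1] by blast
    ultimately have "quadratic_module (\<Union>C)"
      by (simp add: quadratic_module_def)
    then show "\<Union>C \<in> ?A"
      using C(1) CA by blast
  qed (use assms in blast)
  then obtain Q where "Q \<in> ?A" and maximal: "\<forall>X\<in>?A. Q \<subseteq> X \<longrightarrow> X = Q"
    by (rule bexE)
  then have Q: "quadratic_module Q" "M \<subseteq> Q" "- 1 \<notin> Q"
    by auto
  have max: "X = Q" if "quadratic_module X" "- 1 \<notin> X" "Q \<subseteq> X" for X
    using maximal that Q(2) by auto
  have "g \<in> Q \<or> - g \<in> Q" for g
  proof (cases "- 1 \<in> qm_adjoin Q g")
    case True
    then show ?thesis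
      using qm_adjoin_improper[OF Q(1) archimedean_mono[OF arch Q(2)]] by blast
  next
    case False
    then have "qm_adjoin Q g = Q"
      by (intro max quadratic_module_qm_adjoin Q qm_adjoin_superset)
    then show ?thesis
      using qm_adjoin_mem[OF Q(1)] by blast
  qed
  with Q show ?thesis
    by (intro that)
qed

definition qm_infinitesimal :: "('d::finite) rpoly set \<Rightarrow> 'd rpoly \<Rightarrow> bool" where
  "qm_infinitesimal Q h \<longleftrightarrow> (\<forall>\<epsilon>>0. pconst \<epsilon> - h \<in> Q \<and> pconst \<epsilon> + h \<in> Q)"

context
  fixes Q :: "('d::finite) rpoly set"
  assumes Q: "quadratic_module Q"
begin

lemma qm_infinitesimal_0: "qm_infinitesimal Q 0"
  by (auto simp: qm_infinitesimal_def intro!: qm_pconst[OF Q])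

lemma qm_infinitesimal_add:
  assumes "qm_infinitesimal Q g" "qm_infinitesimal Q h"
  shows "qm_infinitesimal Q (g + h)"
  unfolding qm_infinitesimal_def
proof (intro allI impI)
  fix \<epsilon> :: real assume "\<epsilon> > 0"
  then have half: "pconst (\<epsilon>/2) - g \<in> Q" "pconst (\<epsilon>/2) + g \<in> Q"
      "pconst (\<epsilon>/2) - h \<in> Q" "pconst (\<epsilon>/2) + h \<in> Q"
    using assms by (simp_all add: qm_infinitesimal_def)
  have "(pconst (\<epsilon>/2) - g) + (pconst (\<epsilon>/2) - h) \<in> Q"
    by (rule qm_add[OF Q half(1,3)])
  moreover have "(pconst (\<epsilon>/2) + g) + (pconst (\<epsilon>/2) + h) \<in> Q"
    by (rule qm_add[OF Q half(2,4)])
  moreover have "pconst \<epsilon> = pconst (\<epsilon>/2) + (pconst (\<epsilon>/2) :: 'd rpoly)"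
    by (simp flip: pconst_add)
  ultimately show "pconst \<epsilon> - (g + h) \<in> Q \<and> pconst \<epsilon> + (g + h) \<in> Q"
    by (simp add: algebra_simps)
qed

lemma qm_infinitesimal_scale:
  assumes h: "qm_infinitesimal Q h"
  shows "qm_infinitesimal Q (pconst c * h)"
proof -
  have pos: "qm_infinitesimal Q (pconst c * h)" if c: "c > 0" and h: "qm_infinitesimal Q h" for c h
    unfolding qm_infinitesimal_def
  proof (intro allI impI)
    fix \<epsilon> :: real assume "\<epsilon> > 0"
    then have "pconst c * (pconst (\<epsilon>/c) - h) \<in> Q" "pconst c * (pconst (\<epsilon>/c) + h) \<in> Q"
      using c h by (auto simp: qm_infinitesimal_def intro!: qm_scale[OF Q])
    moreover have "pconst c * pconst (\<epsilon>/c) = (pconst \<epsilon> :: 'd rpoly)"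
      using c by (simp flip: pconst_mult)
    ultimately show "pconst \<epsilon> - pconst c * h \<in> Q \<and> pconst \<epsilon> + pconst c * h \<in> Q"
      by (simp add: algebra_simps)
  qed
  have "qm_infinitesimal Q (- h)"
    using h by (auto simp: qm_infinitesimal_def)
  then show ?thesis
    using pos[of c h] pos[of "- c" "- h"] h qm_infinitesimal_0
    by (cases c "0::real" rule: linorder_cases) (auto simp: pconst_uminus)
qed

lemma qm_infinitesimal_square:
  assumes h: "qm_infinitesimal Q h"
  shows "qm_infinitesimal Q (h\<^sup>2)"
  unfolding qm_infinitesimal_def
proof (intro allI impI)
  fix \<epsilon> :: real assume \<epsilon>: "\<epsilon> > 0"
  have "pconst ((sqrt \<epsilon>)\<^sup>2) - h\<^sup>2 \<in> Q"
    using h \<epsilon> by (intro qm_square_bound[OF Q]) (auto simp: qm_infinitesimal_def)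
  moreover have "pconst \<epsilon> + h\<^sup>2 \<in> Q"
    using \<epsilon> by (intro qm_sos[OF Q] sos_add sos_pconst) auto
  ultimately show "pconst \<epsilon> - h\<^sup>2 \<in> Q \<and> pconst \<epsilon> + h\<^sup>2 \<in> Q"
    using \<epsilon> by simp
qed

lemma qm_infinitesimal_mult:
  assumes "qm_infinitesimal Q g" "qm_infinitesimal Q h"
  shows "qm_infinitesimal Q (g * h)"
  unfolding mult_eq_polarized[of g h] using assms
  by (intro qm_infinitesimal_add qm_infinitesimal_scale qm_infinitesimal_square)

text \<open>
  The infinitesimals form an ideal of the polynomials that differ from a real constant by an
  infinitesimal; evaluation at \<open>x\<close> is the corresponding quotient map, determined by its values on
  the variables.
\<close>

lemma qm_infinitesimal_peval:
  assumes var: "\<And>i. qm_infinitesimal Q (pvar i - pconst (x $ i))"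
  shows "qm_infinitesimal Q (p - pconst (peval p x))"
proof (induction p rule: rpoly_induct)
  case (const c)
  then show ?case by (simp add: qm_infinitesimal_0)
next
  case (var i)
  then show ?case by (simp add: assms)
next
  case (add p q)
  from qm_infinitesimal_add[OF this] show ?case
    by (simp add: peval_add pconst_add algebra_simps)
next
  case (mult p q)
  let ?c = "pconst (peval p x)" and ?d = "pconst (peval q x)"
  have "p * q - pconst (peval (p * q) x) = ?c * (q - ?d) + ?d * (p - ?c) + (p - ?c) * (q - ?d)"
    by (simp add: peval_mult pconst_mult algebra_simps)
  then show ?case
    using mult by (auto intro!: qm_infinitesimal_add qm_infinitesimal_scale qm_infinitesimal_mult)
qed

end

text \<open>
  The constants \<open>r\<close> with \<open>p - r \<in> Q\<close> form a Dedekind cut, whose supremum is the required constant.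
  Below it \<open>p - r \<in> Q\<close> by monotonicity, above it \<open>r - p \<in> Q\<close> by totality.
\<close>

lemma ex_standard_part:
  assumes Q: "quadratic_module Q" and arch: "archimedean Q"
    and proper: "- 1 \<notin> Q" and total: "\<And>g. g \<in> Q \<or> - g \<in> Q"
  obtains c where "qm_infinitesimal Q (p - pconst c)"
proof -
  let ?L = "{r. p - pconst r \<in> Q}"
  have neg: "pconst c \<notin> Q" if "c < 0" for c
  proof
    assume "pconst c \<in> Q"
    then have "pconst (1 / - c) * pconst c \<in> Q"
      using that by (intro qm_scale[OF Q]) auto
    moreover have "pconst (1 / - c) * pconst c = (- 1 :: 'a rpoly)"
      using that by (simp flip: pconst_mult pconst_uminus pconst_1)
    ultimately show False using proper by simp
  qed
  obtain b where b: "pconst b - p \<in> Q" "pconst b + p \<in> Q"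
    using archimedean_imp_qm_bounded[OF Q arch] by (auto simp: qm_bounded_def)
  have bdd: "r \<le> b" if "r \<in> ?L" for r
  proof (rule ccontr)
    have "(p - pconst r) + (pconst b - p) \<in> Q"
      using that b by (intro qm_add[OF Q]) auto
    then have "pconst (b - r) \<in> Q"
      by (simp add: pconst_diff)
    moreover assume "\<not> r \<le> b"
    ultimately show False
      using neg[of "b - r"] by simp
  qed
  have "- b \<in> ?L"
    using b by (simp add: pconst_uminus add.commute)
  then have L: "?L \<noteq> {}" "bdd_above ?L"
    using bdd_aboveI[of ?L b, OF bdd] by auto
  have "pconst \<epsilon> - (p - pconst (Sup ?L)) \<in> Q \<and> pconst \<epsilon> + (p - pconst (Sup ?L)) \<in> Q" if eps: "\<epsilon> > 0" for \<epsilon>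
  proof
    have "Sup ?L + \<epsilon> \<notin> ?L"
      using cSup_upper[OF _ L(2), of "Sup ?L + \<epsilon>"] eps by auto
    then have "- (p - pconst (Sup ?L + \<epsilon>)) \<in> Q"
      using total by blast
    then show "pconst \<epsilon> - (p - pconst (Sup ?L)) \<in> Q"
      by (simp add: pconst_add algebra_simps)
    obtain r where "r \<in> ?L" "Sup ?L - \<epsilon> < r"
      using less_cSupD[OF L(1), of "Sup ?L - \<epsilon>"] eps by auto
    then have "p + pconst (\<epsilon> - Sup ?L) \<in> Q"
      using qm_mono_pconst[OF Q, of p "- r" "\<epsilon> - Sup ?L"] by (auto simp: pconst_uminus)
    then show "pconst \<epsilon> + (p - pconst (Sup ?L)) \<in> Q"
      by (simp add: pconst_diff algebra_simps)
  qed
  then show ?thesis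
    by (intro that) (auto simp: qm_infinitesimal_def)
qed

text \<open>
  The point collects the standard parts of the variables in a total extension \<open>Q\<close> of \<open>M\<close>. An element
  of \<open>M\<close> with negative value there would be infinitely close to a negative constant, which would
  then lie in \<open>Q\<close>.
\<close>

lemma ex_nonneg_point:
  assumes M: "quadratic_module M" and arch: "archimedean M" and proper: "- 1 \<notin> M"
  obtains x where "\<And>g. g \<in> M \<Longrightarrow> peval g x \<ge> 0"
proof -
  obtain Q where Q: "quadratic_module Q" "M \<subseteq> Q" "- 1 \<notin> Q" and total: "\<And>g. g \<in> Q \<or> - g \<in> Q"
    using ex_total_quadratic_module[OF assms] by metis
  have "\<exists>c. qm_infinitesimal Q (pvar i - pconst c)" for i
    using ex_standard_part[OF Q(1) archimedean_mono[OF arch Q(2)] Q(3) total] by metis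
  then obtain c where c: "\<And>i. qm_infinitesimal Q (pvar i - pconst (c i))"
    by metis
  define x where "x = (\<chi> i. c i)"
  have inf: "qm_infinitesimal Q (g - pconst (peval g x))" for g
    using c by (intro qm_infinitesimal_peval[OF Q(1)]) (auto simp: x_def)
  have "peval g x \<ge> 0" if "g \<in> M" for g
  proof (rule ccontr)
    define d where "d = - peval g x"
    assume "\<not> peval g x \<ge> 0"
    then have d: "d > 0" by (simp add: d_def)
    then have "pconst (d / 2) - (g - pconst (- d)) \<in> Q"
      using inf[of g] by (simp add: qm_infinitesimal_def d_def)
    then have "pconst (d / 2) - (g - pconst (- d)) + g \<in> Q"
      using that Q by (intro qm_add[OF Q(1)]) auto
    then have "pconst (d / 2) * (- 1) \<in> Q"
      by (simp flip: pconst_add pconst_diff pconst_uminus)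
    then have "- 1 \<in> Q"
      using qm_scale_cancel[OF Q(1), of "d / 2" "- 1"] d by simp
    with Q show False by simp
  qed
  then show ?thesis by (rule that)
qed

text \<open>
  If \<open>f\<close> were not in \<open>M\<close>, adjoining \<open>- f\<close> would give a proper Archimedean quadratic module, which is
  nonnegative at some point; there \<open>f \<le> 0\<close> although all of \<open>M\<close> is nonnegative.
\<close>

theorem putinar:
  assumes M: "quadratic_module M" and arch: "archimedean M"
    and pos: "\<And>x. (\<And>g. g \<in> M \<Longrightarrow> peval g x \<ge> 0) \<Longrightarrow> peval f x > 0"
  shows "f \<in> M"
proof (rule ccontr)
  assume "f \<notin> M"
  then have "- 1 \<notin> qm_adjoin M (- f)"
    using qm_adjoin_improper[OF M arch, of "- f"] by auto
  then obtain x where x: "\<And>g. g \<in> qm_adjoin M (- f) \<Longrightarrow> peval g x \<ge> 0"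
    using ex_nonneg_point[OF quadratic_module_qm_adjoin[OF M] archimedean_mono[OF arch qm_adjoin_superset]]
    by metis
  have "peval (- f) x \<ge> 0"
    by (intro x qm_adjoin_mem M)
  moreover have "peval f x > 0"
    by (intro pos x) (use qm_adjoin_superset in blast)
  ultimately show False
    by (simp add: peval_uminus)
qed

section \<open>Farkas certificates for projected polyhedra\<close>

text \<open>
  A finitely generated convex cone is closed, so a vector outside it is separated from it by a
  hyperplane. The separating functional is nonnegative on each generator, because a negative value
  would become arbitrarily negative along that generator's ray.
\<close>

lemma farkas:
  fixes g :: "'i::finite \<Rightarrow> 'e::euclidean_space"
  assumes dual: "\<And>z. (\<And>i. 0 \<le> z \<bullet> g i) \<Longrightarrow> 0 \<le> z \<bullet> v"
  obtains l where "\<forall>i. 0 \<le> l i" "v = (\<Sum>i\<in>UNIV. l i *\<^sub>R g i)"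
proof -
  let ?K = "convex_cone hull (range g)"
  have "v \<in> ?K"
  proof (rule ccontr)
    assume v: "v \<notin> ?K"
    have "closed ?K"
      by (intro closed_convex_cone_hull) auto
    from separating_hyperplane_closed_point[OF convex_convex_cone_hull this v]
    obtain z b where z: "z \<bullet> v < b" "\<And>x. x \<in> ?K \<Longrightarrow> b < z \<bullet> x"
      by auto
    have "b < 0"
      using z(2)[OF convex_cone_hull_contains_0] by simp
    have "0 \<le> z \<bullet> g i" for i
    proof (rule ccontr)
      assume n: "\<not> 0 \<le> z \<bullet> g i"
      have "(b / (z \<bullet> g i)) *\<^sub>R g i \<in> ?K"
        using n \<open>b < 0\<close> by (intro convex_cone_hull_mul hull_inc) (auto simp: divide_nonpos_neg)
      from z(2)[OF this] n show False by simp
    qed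
    then have "0 \<le> z \<bullet> v"
      by (rule dual)
    with z \<open>b < 0\<close> show False by simp
  qed
  moreover have "?K \<subseteq> {(\<Sum>i\<in>UNIV. l i *\<^sub>R g i) | l. \<forall>i. 0 \<le> l i}" (is "_ \<subseteq> ?S")
  proof (rule hull_minimal)
    show "range g \<subseteq> ?S"
    proof
      fix y assume "y \<in> range g"
      then obtain i where "y = g i" by blast
      then have "y = (\<Sum>j\<in>UNIV. (if j = i then 1 else 0) *\<^sub>R g j)"
        by (simp add: if_distrib[of "\<lambda>c. c *\<^sub>R _"] cong: if_cong)
      then show "y \<in> ?S"
        by (intro CollectI exI[of _ "\<lambda>j. if j = i then 1 else 0"]) auto
    qed
    have "0 \<in> ?S"
      by (intro CollectI exI[of _ "\<lambda>_. 0"]) auto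
    moreover have "x + y \<in> ?S" if xy: "x \<in> ?S" "y \<in> ?S" for x y
    proof -
      obtain l m where "x = (\<Sum>i\<in>UNIV. l i *\<^sub>R g i)" "y = (\<Sum>i\<in>UNIV. m i *\<^sub>R g i)" "\<forall>i. 0 \<le> l i" "\<forall>i. 0 \<le> m i"
        using xy by auto
      then show ?thesis
        by (intro CollectI exI[of _ "\<lambda>i. l i + m i"]) (auto simp: scaleR_left_distrib sum.distrib)
    qed
    moreover have "c *\<^sub>R x \<in> ?S" if x: "x \<in> ?S" and c: "c \<ge> 0" for x c
    proof -
      obtain l where "x = (\<Sum>i\<in>UNIV. l i *\<^sub>R g i)" "\<forall>i. 0 \<le> l i"
        using x by auto
      then show ?thesis
        using c by (intro CollectI exI[of _ "\<lambda>i. c * l i"]) (auto simp: scaleR_right.sum)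
    qed
    ultimately show "convex_cone ?S"
      unfolding convex_cone_iff by blast
  qed
  ultimately show ?thesis
    using that by blast
qed

text \<open>
  One distinguished generator \<open>u\<close>, which below is the vector that makes an affine system homogeneous.
\<close>

lemma farkas_insert:
  fixes g :: "'i::finite \<Rightarrow> 'e::euclidean_space"
  assumes dual: "\<And>z. 0 \<le> z \<bullet> u \<Longrightarrow> (\<And>i. 0 \<le> z \<bullet> g i) \<Longrightarrow> 0 \<le> z \<bullet> v"
  obtains t l where "0 \<le> t" "\<forall>i. 0 \<le> l i" "v = t *\<^sub>R u + (\<Sum>i\<in>UNIV. l i *\<^sub>R g i)"
proof -
  let ?g = "\<lambda>j. case j of None \<Rightarrow> u | Some i \<Rightarrow> g i"
  have "0 \<le> z \<bullet> v" if "\<And>j. 0 \<le> z \<bullet> ?g j" for z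
    using that[of None] that[of "Some _"] by (intro dual) auto
  then obtain l where l: "\<forall>j. 0 \<le> l j" "v = (\<Sum>j\<in>UNIV. l j *\<^sub>R ?g j)"
    using farkas[of ?g v] by metis
  have "v = l None *\<^sub>R u + (\<Sum>i\<in>UNIV. l (Some i) *\<^sub>R g i)"
    unfolding l(2) by (simp add: UNIV_option_conv sum.reindex)
  with l(1) show ?thesis
    by (intro that[of "l None" "\<lambda>i. l (Some i)"]) auto
qed

lemma lifted_polyhedron_iff:
  "(x, y) \<in> lifted_polyhedron a A A' \<longleftrightarrow> (\<forall>i. 0 \<le> a $ i + A $ i \<bullet> x + A' $ i \<bullet> y)"
  by (simp add: lifted_polyhedron_def less_eq_vec_def matrix_vector_mul_component)

text \<open>
  The cone generated by the rows \<open>(a\<^sub>i, A\<^sub>i, A'\<^sub>i)\<close> together with \<open>(1, 0, 0)\<close> contains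
  \<open>(c, v, 0)\<close>: a dual vector \<open>(t, x, y)\<close> with \<open>t > 0\<close> rescales to a point of the polyhedron, and one
  with \<open>t = 0\<close> is a recession direction \<open>(x, y)\<close>, along which \<open>v\<close> cannot decrease because the
  polyhedron is nonempty.
\<close>

lemma affine_farkas:
  fixes a :: "real ^ 'k" and A :: "real ^ 'd ^ 'k" and A' :: "real ^ 'm ^ 'k"
  assumes ne: "lifted_polyhedron a A A' \<noteq> {}"
    and nonneg: "\<And>x. x \<in> projected_polyhedron a A A' \<Longrightarrow> 0 \<le> c + v \<bullet> x"
  obtains l where "\<forall>i. 0 \<le> l i" "(\<Sum>i\<in>UNIV. l i *\<^sub>R A' $ i) = 0"
    "v = (\<Sum>i\<in>UNIV. l i *\<^sub>R A $ i)" "(\<Sum>i\<in>UNIV. l i * a $ i) \<le> c"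
proof -
  obtain x0 y0 where "(x0, y0) \<in> lifted_polyhedron a A A'"
    using ne by auto
  then have xy0: "0 \<le> a $ i + A $ i \<bullet> x0 + A' $ i \<bullet> y0" for i
    by (simp add: lifted_polyhedron_iff)
  have P: "0 \<le> c + v \<bullet> x" if "\<And>i. 0 \<le> a $ i + A $ i \<bullet> x + A' $ i \<bullet> y" for x y
    using that by (intro nonneg) (auto simp: projected_polyhedron_def lifted_polyhedron_iff)
  have "0 \<le> z \<bullet> (c, v, 0)"
    if u: "0 \<le> z \<bullet> (1, 0, 0)" and g: "\<And>i. 0 \<le> z \<bullet> (a $ i, A $ i, A' $ i)"
    for z :: "real \<times> (real ^ 'd) \<times> (real ^ 'm)"
  proof -
    obtain t x y where z: "z = (t, x, y)" by (cases z) auto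
    have t: "t \<ge> 0" using u by (simp add: z)
    have g: "0 \<le> t * a $ i + A $ i \<bullet> x + A' $ i \<bullet> y" for i
      using g[of i] by (simp add: z inner_commute add.assoc mult.commute)
    have "0 \<le> t * c + v \<bullet> x"
    proof (cases "t = 0")
      case False
      have "0 \<le> a $ i + A $ i \<bullet> (x /\<^sub>R t) + A' $ i \<bullet> (y /\<^sub>R t)" for i
      proof -
        have "a $ i + A $ i \<bullet> (x /\<^sub>R t) + A' $ i \<bullet> (y /\<^sub>R t)
            = (t * a $ i + A $ i \<bullet> x + A' $ i \<bullet> y) / t"
          using False by (simp add: field_simps)
        then show ?thesis
          using g[of i] t by simp
      qed
      from P[OF this] have "0 \<le> t * (c + v \<bullet> (x /\<^sub>R t))"
        using t by simp
      then show ?thesis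
        using False by (simp add: distrib_left flip: mult.assoc)
    next
      case True
      show ?thesis
      proof (rule ccontr)
        assume "\<not> 0 \<le> t * c + v \<bullet> x"
        then have neg: "v \<bullet> x < 0" using True by simp
        \<comment> \<open>Far enough along the recession direction for \<open>c + v \<bullet> x\<close> to become negative.\<close>
        define r where "r = (\<bar>c + v \<bullet> x0\<bar> + 1) / - (v \<bullet> x)"
        have r: "r \<ge> 0" using neg by (simp add: r_def divide_nonneg_neg)
        have "0 \<le> a $ i + A $ i \<bullet> (x0 + r *\<^sub>R x) + A' $ i \<bullet> (y0 + r *\<^sub>R y)" for i
        proof -
          have "0 \<le> r * (A $ i \<bullet> x + A' $ i \<bullet> y)"
            using r g[of i] True by simp
          with xy0[of i] show ?thesis
            by (simp add: inner_add_right algebra_simps)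
        qed
        from P[OF this] have "0 \<le> (c + v \<bullet> x0) + r * (v \<bullet> x)"
          by (simp add: inner_add_right algebra_simps)
        moreover have "r * (v \<bullet> x) = - (\<bar>c + v \<bullet> x0\<bar> + 1)"
          using neg by (simp add: r_def)
        ultimately show False by linarith
      qed
    qed
    then show ?thesis
      by (simp add: z inner_commute mult.commute)
  qed
  then obtain t l where tl: "0 \<le> t" "\<forall>i. 0 \<le> l i"
    "(c, v, 0) = t *\<^sub>R (1, 0, 0) + (\<Sum>i\<in>UNIV. l i *\<^sub>R (a $ i, A $ i, A' $ i))"
    by (rule farkas_insert[of "(1, 0, 0)" "\<lambda>i. (a $ i, A $ i, A' $ i)" "(c, v, 0)"]) blast
  then have "c = t + (\<Sum>i\<in>UNIV. l i * a $ i)" "v = (\<Sum>i\<in>UNIV. l i *\<^sub>R A $ i)"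
      "0 = (\<Sum>i\<in>UNIV. l i *\<^sub>R A' $ i)"
    by (auto simp: prod_eq_iff fst_sum snd_sum)
  with tl show ?thesis
    by (intro that[of l]) auto
qed

text \<open>
  Infeasibility of \<open>a + A x + A' y \<ge> 0\<close> in the unknown \<open>y\<close> for this fixed \<open>x\<close>: the cone generated
  by \<open>(1, 0)\<close> and the vectors \<open>((a + A x)\<^sub>i, A'\<^sub>i)\<close> contains \<open>(- 1, 0)\<close>, since a dual vector
  \<open>(t, y)\<close> violating this would have \<open>t > 0\<close> and give the solution \<open>y / t\<close>.
\<close>

lemma not_in_projection_certificate:
  fixes a :: "real ^ 'k" and A :: "real ^ 'd ^ 'k" and A' :: "real ^ 'm ^ 'k"
  assumes x: "x \<notin> projected_polyhedron a A A'"
  obtains l where "\<forall>i. 0 \<le> l i" "(\<Sum>i\<in>UNIV. l i *\<^sub>R A' $ i) = 0"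
    "(\<Sum>i\<in>UNIV. l i * (a $ i + A $ i \<bullet> x)) < 0"
proof -
  let ?b = "\<lambda>i. a $ i + A $ i \<bullet> x"
  have "0 \<le> z \<bullet> (- 1, 0)"
    if u: "0 \<le> z \<bullet> (1, 0)" and g: "\<And>i. 0 \<le> z \<bullet> (?b i, A' $ i)"
    for z :: "real \<times> (real ^ 'm)"
  proof -
    obtain t y where z: "z = (t, y)" by (cases z)
    have "\<not> t > 0"
    proof
      assume t: "t > 0"
      have "0 \<le> ?b i + A' $ i \<bullet> (y /\<^sub>R t)" for i
      proof -
        have "?b i + A' $ i \<bullet> (y /\<^sub>R t) = (t * ?b i + A' $ i \<bullet> y) / t"
          using t by (simp add: field_simps)
        moreover have "0 \<le> t * ?b i + A' $ i \<bullet> y"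
          using g[of i] by (simp add: z inner_commute)
        ultimately show ?thesis
          using t by simp
      qed
      then have "x \<in> projected_polyhedron a A A'"
        unfolding projected_polyhedron_def lifted_polyhedron_iff by blast
      with x show False by blast
    qed
    then show ?thesis by (simp add: z)
  qed
  then obtain t l where tl: "0 \<le> t" "\<forall>i. 0 \<le> l i"
    "(- 1, 0) = t *\<^sub>R (1, 0) + (\<Sum>i\<in>UNIV. l i *\<^sub>R (?b i, A' $ i))"
    by (rule farkas_insert[of "(1, 0)" "\<lambda>i. (?b i, A' $ i)" "(- 1, 0)"]) blast
  then have "- 1 = t + (\<Sum>i\<in>UNIV. l i * ?b i)" "0 = (\<Sum>i\<in>UNIV. l i *\<^sub>R A' $ i)"
    by (auto simp: prod_eq_iff fst_sum snd_sum)
  with tl show ?thesis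
    by (intro that[of l]) auto
qed

section \<open>The lifted quadratic module\<close>

lemma quadratic_module_lifted_module: "quadratic_module (lifted_module a A A')"
  unfolding quadratic_module_def
proof (intro conjI ballI)
  show "1 \<in> lifted_module a A A'"
    unfolding lifted_module_def by (intro CollectI exI[of _ 1] exI[of _ "\<lambda>_. 0"]) auto
  show "p + q \<in> lifted_module a A A'" if pq: "p \<in> lifted_module a A A'" "q \<in> lifted_module a A A'" for p q
  proof -
    obtain s0 s t0 t where p: "p = s0 + (\<Sum>i\<in>UNIV. s i * affine_poly a A i)"
        "\<forall>j. (\<Sum>i\<in>UNIV. s i * pconst (A' $ i $ j)) = 0" "s0 \<in> sos" "\<forall>i. s i \<in> sos"
      and q: "q = t0 + (\<Sum>i\<in>UNIV. t i * affine_poly a A i)"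
        "\<forall>j. (\<Sum>i\<in>UNIV. t i * pconst (A' $ i $ j)) = 0" "t0 \<in> sos" "\<forall>i. t i \<in> sos"
      using pq unfolding lifted_module_def by blast
    show ?thesis
      unfolding lifted_module_def using p q
      by (intro CollectI exI[of _ "s0 + t0"] exI[of _ "\<lambda>i. s i + t i"])
        (auto simp: sum.distrib distrib_right sos_add)
  qed
  show "t * p \<in> lifted_module a A A'" if pt: "p \<in> lifted_module a A A'" and t: "t \<in> sos" for p t
  proof -
    obtain s0 s where p: "p = s0 + (\<Sum>i\<in>UNIV. s i * affine_poly a A i)"
        "\<forall>j. (\<Sum>i\<in>UNIV. s i * pconst (A' $ i $ j)) = 0" "s0 \<in> sos" "\<forall>i. s i \<in> sos"
      using pt unfolding lifted_module_def by blast
    show ?thesis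
      unfolding lifted_module_def using p t
      by (intro CollectI exI[of _ "t * s0"] exI[of _ "\<lambda>i. t * s i"])
        (auto simp: sos_mult distrib_left sum_distrib_left mult.assoc simp flip: sum_distrib_left)
  qed
qed

lemma nonneg_combination_in_lifted_module:
  assumes "\<forall>i. 0 \<le> l i" "(\<Sum>i\<in>UNIV. l i *\<^sub>R A' $ i) = 0"
  shows "(\<Sum>i\<in>UNIV. pconst (l i) * affine_poly a A i) \<in> lifted_module a A A'"
proof -
  have "(\<Sum>i\<in>UNIV. pconst (l i) * pconst (A' $ i $ j)) = 0" for j
  proof -
    have "(\<Sum>i\<in>UNIV. l i * A' $ i $ j) = (\<Sum>i\<in>UNIV. l i *\<^sub>R A' $ i) $ j"
      by simp
    then show ?thesis
      using assms(2) by (simp flip: pconst_mult pconst_sum)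
  qed
  then show ?thesis
    unfolding lifted_module_def using assms(1)
    by (intro CollectI exI[of _ 0] exI[of _ "\<lambda>i. pconst (l i)"]) (auto intro: sos_pconst)
qed

lemma peval_affine_poly: "peval (affine_poly a A i) x = a $ i + A $ i \<bullet> x"
  by (simp add: affine_poly_def peval_add peval_sum peval_mult inner_vec_def)

lemma nonneg_on_lifted_module_imp_in_projection:
  assumes "\<And>g. g \<in> lifted_module a A A' \<Longrightarrow> 0 \<le> peval g x"
  shows "x \<in> projected_polyhedron a A A'"
proof (rule ccontr)
  assume "x \<notin> projected_polyhedron a A A'"
  then obtain l where l: "\<forall>i. 0 \<le> l i" "(\<Sum>i\<in>UNIV. l i *\<^sub>R A' $ i) = 0"
    "(\<Sum>i\<in>UNIV. l i * (a $ i + A $ i \<bullet> x)) < 0"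
    by (rule not_in_projection_certificate) blast
  show False
    using assms[OF nonneg_combination_in_lifted_module[OF l(1,2)]] l(3)
    by (simp add: peval_sum peval_mult peval_affine_poly)
qed

lemma affine_nonneg_in_lifted_module:
  fixes a :: "real ^ 'k" and A :: "real ^ 'd ^ 'k" and A' :: "real ^ 'm ^ 'k"
  assumes ne: "lifted_polyhedron a A A' \<noteq> {}"
    and nonneg: "\<And>x. x \<in> projected_polyhedron a A A' \<Longrightarrow> 0 \<le> c + v \<bullet> x"
  shows "pconst c + (\<Sum>j\<in>UNIV. pconst (v $ j) * pvar j) \<in> lifted_module a A A'"
proof -
  note qm = quadratic_module_lifted_module[of a A A']
  obtain l where l: "\<forall>i. 0 \<le> l i" "(\<Sum>i\<in>UNIV. l i *\<^sub>R A' $ i) = 0"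
    and v: "v = (\<Sum>i\<in>UNIV. l i *\<^sub>R A $ i)" and c: "(\<Sum>i\<in>UNIV. l i * a $ i) \<le> c"
    by (rule affine_farkas[OF ne nonneg]) blast
  have "(\<Sum>i\<in>UNIV. pconst (l i) * affine_poly a A i)
      = pconst (\<Sum>i\<in>UNIV. l i * a $ i) + (\<Sum>i\<in>UNIV. \<Sum>j\<in>UNIV. pconst (l i * A $ i $ j) * pvar j)"
    by (simp add: affine_poly_def distrib_left sum.distrib sum_distrib_left pconst_sum pconst_mult mult.assoc)
  also have "(\<Sum>i\<in>UNIV. \<Sum>j\<in>UNIV. pconst (l i * A $ i $ j) * pvar j) = (\<Sum>j\<in>UNIV. pconst (v $ j) * pvar j)"
    by (subst sum.swap) (simp add: v pconst_sum sum_distrib_right)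
  finally have "(\<Sum>j\<in>UNIV. pconst (v $ j) * pvar j) + pconst (\<Sum>i\<in>UNIV. l i * a $ i) \<in> lifted_module a A A'"
    using nonneg_combination_in_lifted_module[of l A' a A, OF l] by (simp add: add.commute)
  from qm_mono_pconst[OF qm this c] show ?thesis
    by (simp add: add.commute)
qed

text \<open>
  Boundedness of the projection makes \<open>r + x\<^sub>i\<close> and \<open>r - x\<^sub>i\<close> nonnegative on it for some \<open>r\<close>, so both
  are in the module and hence \<open>r\<^sup>2 - x\<^sub>i\<^sup>2\<close> is; these are summed over \<open>i\<close>.
\<close>

lemma archimedean_lifted_module:
  fixes a :: "real ^ 'k" and A :: "real ^ 'd ^ 'k" and A' :: "real ^ 'm ^ 'k"
  assumes ne: "lifted_polyhedron a A A' \<noteq> {}"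
    and bdd: "bounded (projected_polyhedron a A A')"
  shows "archimedean (lifted_module a A A')"
proof -
  let ?M = "lifted_module a A A'"
  note qm = quadratic_module_lifted_module[of a A A']
  obtain r where r: "r > 0" "\<And>x. x \<in> projected_polyhedron a A A' \<Longrightarrow> norm x \<le> r"
    using bdd by (auto simp: bounded_pos)
  have lin: "(\<Sum>j\<in>UNIV. pconst ((b *\<^sub>R axis i 1) $ j) * pvar j) = pconst b * pvar i" for b and i :: 'd
    by (simp add: axis_def if_distrib[of "\<lambda>c. pconst (_ * c) * _"] cong: if_cong)
  have "pconst r + pconst b * pvar i \<in> ?M" if "\<bar>b\<bar> = 1" for b and i :: 'd
  proof -
    have "0 \<le> r + (b *\<^sub>R axis i 1) \<bullet> x" if x: "x \<in> projected_polyhedron a A A'" for x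
    proof -
      have "\<bar>b * x $ i\<bar> \<le> r"
        using r(2)[OF x] component_le_norm_cart[of x i] \<open>\<bar>b\<bar> = 1\<close> by (simp add: abs_mult)
      then show ?thesis
        by (simp add: inner_axis' abs_le_iff)
    qed
    from affine_nonneg_in_lifted_module[OF ne this] show ?thesis
      by (simp only: lin)
  qed
  from this[of 1] this[of "- 1"]
  have "pconst (r\<^sup>2) - (pvar i)\<^sup>2 \<in> ?M" for i
    using r(1) by (intro qm_square_bound[OF qm]) (auto simp: pconst_uminus)
  then have sum: "(\<Sum>i\<in>UNIV. pconst (r\<^sup>2) - (pvar i)\<^sup>2) \<in> ?M"
    by (intro qm_sum[OF qm])
  define N where "N = nat \<lceil>real CARD('d) * r\<^sup>2\<rceil> + 1"
  have "real CARD('d) * r\<^sup>2 \<le> real N"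
    unfolding N_def by linarith
  moreover have "- (\<Sum>i\<in>UNIV. (pvar i :: 'd rpoly)\<^sup>2) + pconst (\<Sum>i\<in>(UNIV :: 'd set). r\<^sup>2)
      = (\<Sum>i\<in>UNIV. pconst (r\<^sup>2) - (pvar i)\<^sup>2)"
    unfolding pconst_sum sum_subtractf by simp
  ultimately have "pconst (real N) - (\<Sum>i\<in>UNIV. (pvar i)\<^sup>2) \<in> ?M"
    using qm_mono_pconst[OF qm, of "- (\<Sum>i\<in>UNIV. (pvar i)\<^sup>2)" "real CARD('d) * r\<^sup>2" "real N"] sum by (simp add: add.commute)
  moreover have "N > 0" by (simp add: N_def)
  ultimately show ?thesis
    unfolding archimedean_def by blast
qed

theorem proposition5p11:
  fixes a :: "real ^ 'k" and A :: "real ^ 'd ^ 'k" and A' :: "real ^ 'm ^ 'k"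
  assumes "lifted_polyhedron a A A' \<noteq> {}"
    and "bounded (projected_polyhedron a A A')"
  shows "quadratic_module (lifted_module a A A')
    \<and> archimedean (lifted_module a A A')
    \<and> (\<forall>p. (\<forall>x\<in>projected_polyhedron a A A'. peval p x > 0) \<longrightarrow> p \<in> lifted_module a A A')"
proof (intro conjI allI impI)
  show qm: "quadratic_module (lifted_module a A A')"
    by (rule quadratic_module_lifted_module)
  show arch: "archimedean (lifted_module a A A')"
    using assms by (rule archimedean_lifted_module)
  fix p assume "\<forall>x\<in>projected_polyhedron a A A'. peval p x > 0"
  then show "p \<in> lifted_module a A A'"
    using nonneg_on_lifted_module_imp_in_projection by (intro putinar[OF qm arch]) blast
qed

end
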